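(* There exists a game $X$ with birthday $3$ such that $X=-X$ and $f(X)\geq 8$.
   Context: Games are normal play two-player (Left and Right) perfect-information games $X=\{L(X)\mid R(X)\}$, with finitely many options and ending in finitely many turns; a player who cannot move on their turn loses. $-X$ is the negative of $X$ (roles of Left and Right swapped). Equality $X=Y$ means that for every game $Z$ the disjunctive sums $X+Z$ and $Y+Z$ have the same outcome. The birthday $b(X)$ of a game $X$ is the least non-negative integer strictly greater than the birthdays of all the (Left and Right) options of $X$. Digraph placement: let $G=(V,E)$ be a finite directed graph (no loops or multiple arcs; both $(u,v)$ and $(v,u)$ may be present) with a (not necessarily proper) colouring $\phi:V\to\{\text{blue},\text{red}\}$. The players alternate; on her turn Left chooses a blue vertex $u$ and deletes its closed out-neighbourhood $N^+[u]$ (that is, $u$ and all out-neighbours of $u$); on his turn Right chooses a red vertex $v$ and deletes $N^+[v]$. A player with no vertex of their colour remaining at the beginning of their turn loses. The coloured digraph $(G,\phi)$, regarded as a combinatorial game in this way, is called a digraph placement game and is denoted $G$. For a game $X$, $f(X)$ denotes the least integer such that there exists a digraph placement game $G$ on $f(X)$ vertices with $G=X$ (it is known that every game $X$ is equal to some digraph placement game, so $f(X)$ is well defined). *)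

theory Defs
  imports "HOL-Library.FSet" "Graph_Theory.Pair_Digraph"
begin

section \<open>Finite normal-play games\<close>

datatype game = Game (left_opts: "game fset") (right_opts: "game fset")

datatype player = Left | Right

primrec opponent :: "player \<Rightarrow> player" where
  "opponent Left = Right"
| "opponent Right = Left"

primrec opts :: "player \<Rightarrow> game \<Rightarrow> game fset" where
  "opts Left X = left_opts X"
| "opts Right X = right_opts X"

lemma size_left_opts: "Y |\<in>| left_opts X \<Longrightarrow> size Y < size X"
proof -
  assume Y: "Y |\<in>| left_opts X"
  have "Suc (size Y) \<le> (\<Sum>Z\<in>fset (left_opts X). Suc (size Z))"
    using Y by (intro member_le_sum) auto
  then show ?thesis by (cases X) auto
qed

lemma size_right_opts: "Y |\<in>| right_opts X \<Longrightarrow> size Y < size X"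
proof -
  assume Y: "Y |\<in>| right_opts X"
  have "Suc (size Y) \<le> (\<Sum>Z\<in>fset (right_opts X). Suc (size Z))"
    using Y by (intro member_le_sum) auto
  then show ?thesis by (cases X) auto
qed

lemma size_opts: "Y |\<in>| opts p X \<Longrightarrow> size Y < size X"
  by (cases p) (auto dest: size_left_opts size_right_opts)

text \<open>\<open>wins p X\<close>: player \<open>p\<close>, moving first in \<open>X\<close>, has a winning strategy.\<close>

function wins :: "player \<Rightarrow> game \<Rightarrow> bool" where
  "wins p X \<longleftrightarrow> (\<exists>Y\<in>fset (opts p X). \<not> wins (opponent p) Y)"
  by auto
termination by (relation "measure (size \<circ> snd)") (auto dest: size_opts)

declare wins.simps [simp del]

datatype outcome = LeftWins | RightWins | NextWins | PreviousWins

definition outcome :: "game \<Rightarrow> outcome" where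
  "outcome X =
    (if wins Left X then (if wins Right X then NextWins else LeftWins)
     else (if wins Right X then RightWins else PreviousWins))"

instantiation game :: "{plus, uminus}"
begin

primrec uminus_game :: "game \<Rightarrow> game" where
  "- (Game L R) = Game (uminus |`| R) (uminus |`| L)"

function plus_game :: "game \<Rightarrow> game \<Rightarrow> game" where
  "X + Y = Game
     ((\<lambda>X'. X' + Y) |`| left_opts X |\<union>| (\<lambda>Y'. X + Y') |`| left_opts Y)
     ((\<lambda>X'. X' + Y) |`| right_opts X |\<union>| (\<lambda>Y'. X + Y') |`| right_opts Y)"
  by auto
termination
  by (relation "measure (\<lambda>(X, Y). size X + size Y)")
     (auto dest: size_left_opts size_right_opts)

instance ..

end

declare plus_game.simps [simp del]

text \<open>HOL equality on \<^typ>\<open>game\<close> is identity of game trees; \<open>game_eq\<close> is equality of game values.\<close>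

definition game_eq :: "game \<Rightarrow> game \<Rightarrow> bool" where
  "game_eq X Y \<longleftrightarrow> (\<forall>Z. outcome (X + Z) = outcome (Y + Z))"

primrec birthday :: "game \<Rightarrow> nat" where
  "birthday (Game L R) = (LEAST n. \<forall>b \<in> fset (birthday |`| L |\<union>| birthday |`| R). b < n)"

section \<open>Digraph placement\<close>

datatype colour = Blue | Red

definition closed_out_nbhd :: "'a pair_pre_digraph \<Rightarrow> 'a \<Rightarrow> 'a set" where
  "closed_out_nbhd G u = insert u {v. (u, v) \<in> parcs G}"

definition delete_verts :: "'a pair_pre_digraph \<Rightarrow> 'a set \<Rightarrow> 'a pair_pre_digraph" where
  "delete_verts G S =
    \<lparr> pverts = pverts G - S, parcs = {(u, v) \<in> parcs G. u \<notin> S \<and> v \<notin> S} \<rparr>"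

text \<open>The case of an infinite vertex set is a dummy that makes the recursion well-founded; for
  finite \<open>G\<close>, \<^const>\<open>Abs_fset\<close> is only applied to finite sets. Only the values of the
  colouring on \<^term>\<open>pverts G\<close> matter.\<close>

function placement_game :: "'a pair_pre_digraph \<Rightarrow> ('a \<Rightarrow> colour) \<Rightarrow> game" where
  "placement_game G \<phi> =
    (if finite (pverts G) then
       Game
         (Abs_fset ((\<lambda>u. placement_game (delete_verts G (closed_out_nbhd G u)) \<phi>) `
            {u \<in> pverts G. \<phi> u = Blue}))
         (Abs_fset ((\<lambda>v. placement_game (delete_verts G (closed_out_nbhd G v)) \<phi>) `
            {v \<in> pverts G. \<phi> v = Red}))
     else Game {||} {||})"
  by auto
termination
  by (relation "measure (\<lambda>(G, \<phi>). card (pverts G))")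
     (auto simp: delete_verts_def closed_out_nbhd_def intro!: psubset_card_mono)

declare placement_game.simps [simp del]

text \<open>Vertices are taken in \<^typ>\<open>nat\<close> without loss of generality, since a finite digraph is
  determined up to isomorphism by a copy on natural numbers. The locale predicate
  \<^const>\<open>pair_digraph\<close> says that \<open>G\<close> is finite and loopless; arcs are pairs, so there are no
  multiple arcs.\<close>

definition placement_number :: "game \<Rightarrow> nat" where
  "placement_number X =
    (LEAST n. \<exists>(G :: nat pair_pre_digraph) \<phi>.
       pair_digraph G \<and> card (pverts G) = n \<and> game_eq (placement_game G \<phi>) X)"

end

theory Submission
  imports Defs
begin

text \<open>
  The witness is \<open>X = {0, U, P | 0, -U, -P}\<close> with \<open>U = {0, * | 0}\<close> and \<open>P = {1 | 0, *}\<close>, which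
  is its own negative. Suppose a digraph \<open>G\<close> on at most seven vertices has value \<open>X\<close>; up to
  negation it has at most three blue vertices. Since \<open>X\<close> is in canonical form, every Left option
  of \<open>X\<close> lies below some Left option of \<open>G\<close>, and if the latter were reversible, \<open>U\<close> and \<open>P\<close> would
  have to reappear below Left options of positions with too few blue vertices to allow it. So there
  are exactly three blue vertices \<open>u\<close>, \<open>v\<close>, \<open>w\<close>, whose moves lead to a position \<open>\<ge> 0\<close>, to \<open>U\<close>
  and to \<open>P\<close> respectively, and there are at most four red vertices. The Left options \<open>1\<close> of \<open>P\<close> and
  \<open>*\<close> of \<open>U\<close> force \<open>u\<close> and \<open>w\<close> together to delete all red vertices and leave no arcs between blue
  vertices, except perhaps from \<open>u\<close> to \<open>w\<close>; the position after \<open>u\<close> excludes this arc as well. That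
  position also provides two red vertices deleted by \<open>w\<close> only, one of which deletes \<open>w\<close>; the
  position after \<open>w\<close> provides two deleted by \<open>u\<close> only, one of which deletes \<open>u\<close>. These are all red
  vertices. Then no Left option of the position after \<open>v\<close> can lie above the Left option \<open>0\<close> of \<open>U\<close>:
  it would have to be reversible through a position of value \<open>1\<close>, which is not below \<open>U\<close>.
\<close>

section \<open>The order on games\<close>

text \<open>Conway's order, by recursion on options alone: without disjunctive sums, comparisons of
  concrete games become finite computations.\<close>

function game_le :: "game \<Rightarrow> game \<Rightarrow> bool" (infix \<open>\<preceq>\<close> 50) where
  "X \<preceq> Y \<longleftrightarrow>
    (\<forall>x \<in> fset (left_opts X). \<not> Y \<preceq> x) \<and> (\<forall>y \<in> fset (right_opts Y). \<not> y \<preceq> X)"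
  by auto
termination
  by (relation "measure (\<lambda>(X, Y). size X + size Y)")
     (auto dest: size_left_opts size_right_opts)

declare game_le.simps [simp del]

lemma game_le_Game:
  "Game A B \<preceq> Game C D \<longleftrightarrow>
    (\<forall>x \<in> fset A. \<not> Game C D \<preceq> x) \<and> (\<forall>y \<in> fset D. \<not> y \<preceq> Game A B)"
  by (subst game_le.simps) simp

lemma game_le_refl [simp]: "X \<preceq> X"
proof (induction X rule: measure_induct_rule [of size])
  case (less X)
  have "\<not> X \<preceq> x" if "x |\<in>| left_opts X" for x
    using less [OF size_left_opts [OF that]] that by (subst game_le.simps) blast
  moreover have "\<not> x \<preceq> X" if "x |\<in>| right_opts X" for x
    using less [OF size_right_opts [OF that]] that by (subst game_le.simps) blast
  ultimately show ?case
    by (subst game_le.simps) blast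
qed

lemma game_le_trans:
  assumes "X \<preceq> Y" "Y \<preceq> Z"
  shows "X \<preceq> Z"
  using assms
proof (induction "size X + size Y + size Z" arbitrary: X Y Z rule: less_induct)
  case less
  have "\<not> Z \<preceq> x" if "x |\<in>| left_opts X" for x
    using less.hyps [of Y Z x] less.prems that size_left_opts [OF that]
      game_le.simps [of X Y] by auto
  moreover have "\<not> z \<preceq> X" if "z |\<in>| right_opts Z" for z
    using less.hyps [of z X Y] less.prems that size_right_opts [OF that]
      game_le.simps [of Y Z] by auto
  ultimately show ?case
    by (subst game_le.simps) blast
qed

lemma left_opts_uminus [simp]: "left_opts (- X) = uminus |`| right_opts X"
  and right_opts_uminus [simp]: "right_opts (- X) = uminus |`| left_opts X"
  for X :: game
  by (cases X; simp)+

lemma left_opts_plus: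
  "left_opts (X + Y) = (\<lambda>X'. X' + Y) |`| left_opts X |\<union>| (\<lambda>Y'. X + Y') |`| left_opts Y"
  and right_opts_plus:
  "right_opts (X + Y) = (\<lambda>X'. X' + Y) |`| right_opts X |\<union>| (\<lambda>Y'. X + Y') |`| right_opts Y"
  for X Y :: game
  by (subst plus_game.simps, simp)+

lemma wins_plus:
  fixes X Y :: game
  shows "wins Left (X + Y) \<longleftrightarrow>
      (\<exists>x \<in> fset (left_opts X). \<not> wins Right (x + Y)) \<or>
      (\<exists>y \<in> fset (left_opts Y). \<not> wins Right (X + y))"
    and "wins Right (X + Y) \<longleftrightarrow>
      (\<exists>x \<in> fset (right_opts X). \<not> wins Left (x + Y)) \<or>
      (\<exists>y \<in> fset (right_opts Y). \<not> wins Left (X + y))"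
  by (simp_all add: wins.simps [of _ "X + Y"] left_opts_plus right_opts_plus bex_Un)

text \<open>Moves in \<open>X + - Y\<close> correspond to the options inspected by
  \<open>game_le\<close>. Hence the single test summand \<open>- Y\<close> turns
  \<open>game_eq X Y\<close> into both inequalities.\<close>

lemma wins_minus_iff:
  "(wins Left (X + - Y) \<longleftrightarrow> \<not> X \<preceq> Y) \<and> (wins Right (X + - Y) \<longleftrightarrow> \<not> Y \<preceq> X)"
proof (induction "size X + size Y" arbitrary: X Y rule: less_induct)
  case less
  have L: "(wins Left (x + - Y) \<longleftrightarrow> \<not> x \<preceq> Y) \<and> (wins Right (x + - Y) \<longleftrightarrow> \<not> Y \<preceq> x)"
    if "x |\<in>| left_opts X \<or> x |\<in>| right_opts X" for x
    using less [of x Y] that size_left_opts [of x X] size_right_opts [of x X] by auto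
  have R: "(wins Left (X + - y) \<longleftrightarrow> \<not> X \<preceq> y) \<and> (wins Right (X + - y) \<longleftrightarrow> \<not> y \<preceq> X)"
    if "y |\<in>| left_opts Y \<or> y |\<in>| right_opts Y" for y
    using less [of X y] that size_left_opts [of y Y] size_right_opts [of y Y] by auto
  show ?case
    unfolding wins_plus [of X "- Y"] game_le.simps [of X Y] game_le.simps [of Y X]
    using L R by auto
qed

lemma game_le_if_game_eq:
  assumes "game_eq X Y"
  shows "X \<preceq> Y" "Y \<preceq> X"
proof -
  have "outcome (X + - Y) = outcome (Y + - Y)"
    using assms by (simp add: game_eq_def)
  then show "X \<preceq> Y" "Y \<preceq> X"
    by (auto simp: outcome_def wins_minus_iff split: if_splits)
qed

text \<open>Let Left win by moving from \<open>X\<close> to \<open>x\<close>. As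
  \<open>Y \<preceq> x\<close> fails, either a Left option of \<open>Y\<close> above
  \<open>x\<close> serves instead, or some Right option \<open>x'\<close> of \<open>x\<close> is
  below \<open>Y\<close>; Left wins moving first in \<open>x' + Z\<close>, and induction carries
  this over to \<open>Y + Z\<close>.\<close>

lemma wins_mono:
  assumes "X \<preceq> Y"
  shows "(wins Left (X + Z) \<longrightarrow> wins Left (Y + Z)) \<and>
    (wins Right (Y + Z) \<longrightarrow> wins Right (X + Z))"
  using assms
proof (induction "size X + size Y + size Z" arbitrary: X Y Z rule: less_induct)
  case less
  have Z: "(wins Left (X + z) \<longrightarrow> wins Left (Y + z)) \<and>
      (wins Right (Y + z) \<longrightarrow> wins Right (X + z))"
    if "z |\<in>| left_opts Z \<or> z |\<in>| right_opts Z" for z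
    using less.hyps [of X Y z] less.prems that size_left_opts [of z Z] size_right_opts [of z Z]
    by auto
  have "wins Left (Y + Z)" if x: "x |\<in>| left_opts X" "\<not> wins Right (x + Z)" for x
  proof -
    have "\<not> Y \<preceq> x"
      using less.prems x(1) by (subst (asm) game_le.simps) blast
    then consider y where "y |\<in>| left_opts Y" "x \<preceq> y"
      | x' where "x' |\<in>| right_opts x" "x' \<preceq> Y"
      by (subst (asm) game_le.simps) blast
    then show ?thesis
    proof cases
      case 1
      then have "\<not> wins Right (y + Z)"
        using less.hyps [of x y Z] x size_left_opts [of x X] size_left_opts [of y Y] by auto
      with 1 show ?thesis
        by (subst wins_plus) blast
    next
      case 2
      then have "wins Left (x' + Z)"
        using x(2) by (subst (asm) wins_plus) blast
      then show ?thesis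
        using less.hyps [of x' Y Z] 2 size_left_opts [OF x(1)] size_right_opts [OF 2(1)] by auto
    qed
  qed
  moreover have "wins Right (X + Z)" if y: "y |\<in>| right_opts Y" "\<not> wins Left (y + Z)" for y
  proof -
    have "\<not> y \<preceq> X"
      using less.prems y(1) by (subst (asm) game_le.simps) blast
    then consider x where "x |\<in>| right_opts X" "x \<preceq> y"
      | y' where "y' |\<in>| left_opts y" "X \<preceq> y'"
      by (subst (asm) game_le.simps) blast
    then show ?thesis
    proof cases
      case 1
      then have "\<not> wins Left (x + Z)"
        using less.hyps [of x y Z] y size_right_opts [of x X] size_right_opts [of y Y] by auto
      with 1 show ?thesis
        by (subst wins_plus) blast
    next
      case 2
      then have "wins Right (y' + Z)"
        using y(2) by (subst (asm) wins_plus) blast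
      then show ?thesis
        using less.hyps [of X y' Z] 2 size_right_opts [OF y(1)] size_left_opts [OF 2(1)] by auto
    qed
  qed
  ultimately show ?case
    unfolding wins_plus [of X Z] wins_plus [of Y Z] using Z by blast
qed

lemma game_eq_if_game_le:
  assumes "X \<preceq> Y" "Y \<preceq> X"
  shows "game_eq X Y"
  unfolding game_eq_def outcome_def using wins_mono [OF assms(1)] wins_mono [OF assms(2)] by auto

section \<open>Positions of a placement game as vertex sets\<close>

text \<open>The digraph stays fixed and only the vertex set shrinks, so moves made in different
  orders reach literally the same position.\<close>

function pos :: "('a \<Rightarrow> 'a set) \<Rightarrow> ('a \<Rightarrow> colour) \<Rightarrow> 'a set \<Rightarrow> game" where
  "pos N c S =
    (if finite S then
       Game
         (Abs_fset ((\<lambda>u. pos N c (S - insert u (N u))) ` {u \<in> S. c u = Blue}))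
         (Abs_fset ((\<lambda>u. pos N c (S - insert u (N u))) ` {u \<in> S. c u = Red}))
     else Game {||} {||})"
  by auto
termination
  by (relation "measure (\<lambda>(N, c, S). card S)") (auto intro!: psubset_card_mono)

declare pos.simps [simp del]

lemma opts_pos:
  assumes "finite S"
  shows "fset (left_opts (pos N c S)) =
      (\<lambda>u. pos N c (S - insert u (N u))) ` {u \<in> S. c u = Blue}"
    and "fset (right_opts (pos N c S)) =
      (\<lambda>u. pos N c (S - insert u (N u))) ` {u \<in> S. c u = Red}"
  using assms by (subst pos.simps; simp add: Abs_fset_inverse)+

lemma placement_game_eq_pos:
  assumes "\<And>u. u \<in> pverts G \<Longrightarrow> closed_out_nbhd G u \<inter> pverts G = insert u (N u) \<inter> pverts G"
  shows "placement_game G c = pos N c (pverts G)"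
  using assms
proof (induction "card (pverts G)" arbitrary: G rule: less_induct)
  case less
  show ?case
  proof (cases "finite (pverts G)")
    case True
    have "placement_game (delete_verts G (closed_out_nbhd G u)) c =
        pos N c (pverts G - insert u (N u))" if u: "u \<in> pverts G" for u
    proof -
      let ?H = "delete_verts G (closed_out_nbhd G u)"
      have V: "pverts ?H = pverts G - insert u (N u)"
        using less.prems [OF u] by (auto simp: delete_verts_def)
      have "card (pverts ?H) < card (pverts G)"
        unfolding V using True u by (intro psubset_card_mono) auto
      moreover have "closed_out_nbhd ?H v \<inter> pverts ?H = insert v (N v) \<inter> pverts ?H"
        if "v \<in> pverts ?H" for v
      proof -
        have "v \<in> pverts G"
          using that by (simp add: V)
        have "closed_out_nbhd ?H v \<inter> pverts ?H = (closed_out_nbhd G v \<inter> pverts G) \<inter> pverts ?H"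
          using that by (auto simp: delete_verts_def closed_out_nbhd_def)
        also have "\<dots> = insert v (N v) \<inter> pverts ?H"
          unfolding less.prems [OF \<open>v \<in> pverts G\<close>] V by blast
        finally show ?thesis .
      qed
      ultimately show ?thesis
        using less.hyps V by metis
    qed
    then show ?thesis
      by (subst placement_game.simps, subst pos.simps) (simp cong: image_cong_simp)
  qed (simp add: placement_game.simps pos.simps)
qed

section \<open>Negation as exchange of colours\<close>

primrec swap_colour :: "colour \<Rightarrow> colour" where
  "swap_colour Blue = Red"
| "swap_colour Red = Blue"

lemma swap_colour_eq_iff [simp]:
  "swap_colour x = Red \<longleftrightarrow> x = Blue" "swap_colour x = Blue \<longleftrightarrow> x = Red"
  by (cases x; simp)+

lemma game_eqI:
  "fset (left_opts X) = fset (left_opts Y) \<Longrightarrow> fset (right_opts X) = fset (right_opts Y) \<Longrightarrow> X = Y"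
  by (cases X; cases Y) (simp add: fset_inject)

lemma uminus_pos: "finite S \<Longrightarrow> - pos N c S = pos N (swap_colour \<circ> c) S"
proof (induction "card S" arbitrary: S rule: less_induct)
  case less
  have IH: "- pos N c (S - insert u (N u)) = pos N (swap_colour \<circ> c) (S - insert u (N u))"
    if "u \<in> S" for u
    using that less.prems by (intro less.hyps psubset_card_mono) auto
  show ?case
    by (rule game_eqI) (auto simp: opts_pos less.prems image_image IH cong: image_cong_simp)
qed

lemma uminus_game_le: "- X \<preceq> - Y \<longleftrightarrow> Y \<preceq> X"
proof (induction "size X + size Y" arbitrary: X Y rule: less_induct)
  case less
  have "- y \<preceq> - X \<longleftrightarrow> X \<preceq> y" if "y |\<in>| left_opts Y" for y
    using less [of y X] size_left_opts [OF that] by simp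
  moreover have "- Y \<preceq> - x \<longleftrightarrow> x \<preceq> Y" if "x |\<in>| right_opts X" for x
    using less [of Y x] size_right_opts [OF that] by simp
  ultimately show ?case
    unfolding game_le.simps [of "- X" "- Y"] game_le.simps [of Y X] by auto
qed


section \<open>The game\<close>

definition zero :: game where "zero = Game {||} {||}"
definition one :: game where "one = Game {|zero|} {||}"
definition star :: game where "star = Game {|zero|} {|zero|}"
text \<open>The canonical form of up plus star.\<close>

definition up_star :: game where "up_star = Game {|zero, star|} {|zero|}"
definition hot :: game where "hot = Game {|one|} {|zero, star|}"
definition witness :: game where
  "witness = Game {|zero, up_star, hot|} {|zero, - up_star, - hot|}"

lemmas game_defs = zero_def one_def star_def up_star_def hot_def witness_def

lemma opts_simps [simp]:
  "left_opts zero = {||}" "right_opts zero = {||}"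
  "left_opts one = {|zero|}" "right_opts one = {||}"
  "left_opts star = {|zero|}" "right_opts star = {|zero|}"
  "left_opts up_star = {|zero, star|}" "right_opts up_star = {|zero|}"
  "left_opts hot = {|one|}" "right_opts hot = {|zero, star|}"
  "left_opts witness = {|zero, up_star, hot|}"
  by (simp_all add: game_defs)

lemma uminus_witness: "- witness = witness"
  by (auto simp: game_defs)

lemma birthday_witness: "birthday witness = 3"
proof -
  have less: "(LEAST n::nat. \<forall>b \<in> fset B. b < n) = Suc m"
    if "\<forall>b \<in> fset B. b \<le> m" "m |\<in>| B" for B and m :: nat
    using that by (intro Least_equality) (auto simp: Suc_le_eq)
  have zero: "birthday zero = 0"
    by (simp add: zero_def)
  have neg: "- one = Game {||} {|zero|}" "- up_star = Game {|zero|} {|zero, star|}"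
    "- hot = Game {|zero, star|} {|- one|}"
    by (auto simp: game_defs)
  have one: "birthday star = Suc 0" "birthday one = Suc 0" "birthday (- one) = Suc 0"
    unfolding star_def one_def neg(1) [unfolded one_def] birthday.simps
    by (rule less; simp add: zero)+
  have "birthday up_star = Suc (Suc 0)" "birthday (- up_star) = Suc (Suc 0)"
    "birthday hot = Suc (Suc 0)" "birthday (- hot) = Suc (Suc 0)"
    unfolding neg(2,3) unfolding up_star_def hot_def birthday.simps
    by (rule less; simp add: zero one)+
  then show ?thesis
    unfolding witness_def birthday.simps numeral_3_eq_3 by (intro less) (simp_all add: zero)
qed

lemma not_game_le:
  "\<not> zero \<preceq> witness" "\<not> star \<preceq> zero" "\<not> zero \<preceq> star"
  "\<not> one \<preceq> zero" "\<not> one \<preceq> up_star" "\<not> zero \<preceq> up_star"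
  "\<not> zero \<preceq> hot" "\<not> hot \<preceq> zero"
  "\<not> hot \<preceq> up_star"
  by (simp_all add: game_defs game_le_Game)

section \<open>The lower bound\<close>

definition at_most_blue :: "nat \<Rightarrow> ('a \<Rightarrow> colour) \<Rightarrow> 'a set \<Rightarrow> bool" where
  "at_most_blue n c S \<longleftrightarrow> finite S \<and> card {u \<in> S. c u = Blue} \<le> n"

text \<open>A Left option of \<open>X\<close> with these properties cannot lie below a Left option of a position with
  at most two blue vertices that is \<open>\<le> X\<close>; in particular it cannot be hidden behind a reversible
  option of a digraph with three blue vertices.\<close>

definition robust :: "game \<Rightarrow> game \<Rightarrow> bool" where
  "robust A X \<longleftrightarrow> A |\<in>| left_opts X \<and>
    (\<forall>x \<in> fset (left_opts X). A \<preceq> x \<longrightarrow> x \<preceq> A) \<and>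
    (\<forall>y \<in> fset (right_opts A). \<not> y \<preceq> X) \<and> \<not> A \<preceq> zero \<and>
    (\<exists>a \<in> fset (left_opts A). \<not> a \<preceq> zero \<and> (\<forall>y \<in> fset (right_opts a). \<not> y \<preceq> A))"

lemma up_star_le_one: "up_star \<preceq> one"
  by (simp add: game_defs game_le_Game)

lemma robust_witness: "robust up_star witness" "robust hot witness"
  by (simp_all add: robust_def game_defs game_le_Game)

section \<open>Comparing positions of a fixed coloured digraph\<close>

locale placement =
  fixes N :: "'a \<Rightarrow> 'a set" and c :: "'a \<Rightarrow> colour"
begin

abbreviation p :: "'a set \<Rightarrow> game" where
  "p \<equiv> pos N c"

definition del :: "'a set \<Rightarrow> 'a \<Rightarrow> 'a set" where
  "del S u = S - insert u (N u)"

lemma finite_del [simp]: "finite S \<Longrightarrow> finite (del S u)"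
  by (simp add: del_def)

lemma del_subset: "del S u \<subseteq> S"
  by (auto simp: del_def)

lemma del_commute: "del (del S u) v = del (del S v) u"
  by (auto simp: del_def)

lemma p_le_iff:
  assumes "finite S"
  shows "p S \<preceq> Y \<longleftrightarrow>
    (\<forall>b \<in> S. c b = Blue \<longrightarrow> \<not> Y \<preceq> p (del S b)) \<and>
    (\<forall>y \<in> fset (right_opts Y). \<not> y \<preceq> p S)"
  by (subst game_le.simps) (auto simp: opts_pos assms del_def)

lemma le_p_iff:
  assumes "finite S"
  shows "Y \<preceq> p S \<longleftrightarrow>
    (\<forall>y \<in> fset (left_opts Y). \<not> p S \<preceq> y) \<and>
    (\<forall>r \<in> S. c r = Red \<longrightarrow> \<not> p (del S r) \<preceq> Y)"
  by (subst game_le.simps) (auto simp: opts_pos assms del_def)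

lemma p_le_zero:
  assumes "at_most_blue 0 c S"
  shows "p S \<preceq> zero"
  using assms by (subst p_le_iff) (auto simp: at_most_blue_def zero_def)

lemma le_zero_if_le_p:
  "Y \<preceq> p S \<Longrightarrow> at_most_blue 0 c S \<Longrightarrow> Y \<preceq> zero"
  using game_le_trans p_le_zero by blast

lemma zero_le_p:
  assumes "finite S" "\<And>r. r \<in> S \<Longrightarrow> c r \<noteq> Red"
  shows "zero \<preceq> p S"
  using assms by (subst le_p_iff) (auto simp: zero_def)

lemma one_le_p_singleton:
  assumes "c u = Blue"
  shows "one \<preceq> p {u}"
  using assms p_le_iff [of "{u}" zero] zero_le_p [of "del {u} u"]
  by (subst le_p_iff) (auto simp: one_def del_def)

lemma at_most_blue_del:
  assumes "at_most_blue (Suc n) c S" "b \<in> S" "c b = Blue"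
  shows "at_most_blue n c (del S b)"
proof -
  have "card {u \<in> del S b. c u = Blue} < card {u \<in> S. c u = Blue}"
    using assms by (intro psubset_card_mono) (auto simp: at_most_blue_def del_def)
  with assms(1) show ?thesis
    by (simp add: at_most_blue_def)
qed

lemma at_most_blue_mono:
  assumes "at_most_blue n c S" "T \<subseteq> S"
  shows "at_most_blue n c T"
proof -
  have "card {u \<in> T. c u = Blue} \<le> card {u \<in> S. c u = Blue}"
    using assms by (intro card_mono) (auto simp: at_most_blue_def)
  with assms show ?thesis
    using finite_subset by (auto simp: at_most_blue_def)
qed

lemma at_most_blue_del_any: "at_most_blue n c S \<Longrightarrow> at_most_blue n c (del S u)"
  using at_most_blue_mono del_subset by blast

lemma finite_if_at_most_blue: "at_most_blue n c S \<Longrightarrow> finite S"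
  by (simp add: at_most_blue_def)


text \<open>There are two reasons why \<open>X \<preceq> p K\<close> can fail. If \<open>p K\<close>
  is below a Left option of \<open>X\<close>, maximality of \<open>A\<close> gives
  \<open>p K\<close> the value of \<open>A\<close>, and the Left option \<open>a\<close> of
  \<open>A\<close> must be matched by a blue move that leaves no blue vertex, so
  \<open>a \<preceq> zero\<close>. If a red move leads below \<open>X\<close>, Left needs an answer
  above \<open>A\<close>, again without blue vertices, so \<open>A \<preceq> zero\<close>.\<close>

lemma not_robust_le_if_at_most_one_blue:
  assumes A: "robust A X" and K: "at_most_blue 1 c K" "A \<preceq> p K" "\<not> X \<preceq> p K"
  shows False
proof -
  have [simp]: "finite K"
    using K(1) by (rule finite_if_at_most_blue)
  consider x where "x |\<in>| left_opts X" "p K \<preceq> x"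
    | r where "r \<in> K" "c r = Red" "p (del K r) \<preceq> X"
    using K(3) by (auto simp: le_p_iff)
  then show False
  proof cases
    case 1
    then have KA: "p K \<preceq> A"
      using A K(2) game_le_trans unfolding robust_def by blast
    from A obtain a where a: "a |\<in>| left_opts A" "\<not> a \<preceq> zero"
      "\<forall>y \<in> fset (right_opts a). \<not> y \<preceq> A"
      by (auto simp: robust_def)
    have "\<not> p K \<preceq> a"
      using K(2) a(1) by (auto simp: le_p_iff)
    moreover have "\<forall>y \<in> fset (right_opts a). \<not> y \<preceq> p K"
      using a(3) KA game_le_trans by blast
    ultimately obtain b where b: "b \<in> K" "c b = Blue" "a \<preceq> p (del K b)"
      by (auto simp: p_le_iff)
    then show False
      using le_zero_if_le_p at_most_blue_del [of 0 K b] K(1) a(2) by simp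
  next
    case 2
    have "\<not> p (del K r) \<preceq> A"
      using K(2) 2 by (auto simp: le_p_iff)
    moreover have "\<forall>y \<in> fset (right_opts A). \<not> y \<preceq> p (del K r)"
      using A 2(3) game_le_trans unfolding robust_def by blast
    ultimately obtain b where b: "b \<in> del K r" "c b = Blue" "A \<preceq> p (del (del K r) b)"
      by (auto simp: p_le_iff)
    then show False
      using le_zero_if_le_p at_most_blue_del [of 0 "del K r" b] at_most_blue_del_any K(1) A
      by (simp add: robust_def)
  qed
qed

text \<open>Otherwise some blue move leads above \<open>A\<close> with at most one blue vertex left;
  the new position is not above \<open>X\<close>, because \<open>p W \<preceq> X\<close>.\<close>

lemma p_le_robust_if_at_most_two_blue:
  assumes A: "robust A X" and W: "at_most_blue 2 c W" "p W \<preceq> X"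
  shows "p W \<preceq> A"
proof (rule ccontr)
  assume "\<not> p W \<preceq> A"
  have [simp]: "finite W"
    using W(1) by (rule finite_if_at_most_blue)
  have "\<forall>y \<in> fset (right_opts A). \<not> y \<preceq> p W"
    using A W(2) game_le_trans unfolding robust_def by blast
  with \<open>\<not> p W \<preceq> A\<close> obtain b where b: "b \<in> W" "c b = Blue" "A \<preceq> p (del W b)"
    by (auto simp: p_le_iff)
  moreover have "\<not> X \<preceq> p (del W b)"
    using W(2) b by (auto simp: p_le_iff)
  moreover have "at_most_blue 1 c (del W b)"
    using W(1) b at_most_blue_del [of 1] by (simp add: numeral_2_eq_2)
  ultimately show False
    using A not_robust_le_if_at_most_one_blue by blast
qed

text \<open>A Left option above \<open>A\<close> exists because \<open>A\<close> is not reversible.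
  It has the value of \<open>A\<close>: reversing it by a red move to a position below
  \<open>X\<close> would put that position below \<open>A\<close>.\<close>

lemma robust_option:
  assumes A: "robust A X" and S: "at_most_blue 3 c S" "p S \<preceq> X" "X \<preceq> p S"
  obtains v where "v \<in> S" "c v = Blue" "A \<preceq> p (del S v)" "p (del S v) \<preceq> A"
proof -
  have [simp]: "finite S"
    using S(1) by (rule finite_if_at_most_blue)
  have "\<not> p S \<preceq> A"
    using S(3) A by (auto simp: le_p_iff robust_def)
  moreover have "\<forall>y \<in> fset (right_opts A). \<not> y \<preceq> p S"
    using A S(2) game_le_trans unfolding robust_def by blast
  ultimately obtain v where v: "v \<in> S" "c v = Blue" "A \<preceq> p (del S v)"
    by (auto simp: p_le_iff)
  have two: "at_most_blue 2 c (del S v)"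
    using S(1) v at_most_blue_del [of 2] by (simp add: numeral_3_eq_3 numeral_2_eq_2)
  have "\<not> X \<preceq> p (del S v)"
    using S(2) v by (auto simp: p_le_iff)
  then consider x where "x |\<in>| left_opts X" "p (del S v) \<preceq> x"
    | r where "r \<in> del S v" "c r = Red" "p (del (del S v) r) \<preceq> X"
    by (auto simp: le_p_iff)
  then have "p (del S v) \<preceq> A"
  proof cases
    case 1
    then show ?thesis
      using A v(3) game_le_trans unfolding robust_def by blast
  next
    case 2
    then have "p (del (del S v) r) \<preceq> A"
      using A two at_most_blue_del_any p_le_robust_if_at_most_two_blue by blast
    then show ?thesis
      using v(3) 2 by (auto simp: le_p_iff)
  qed
  with v show thesis
    by (rule that)
qed


section \<open>Excluding digraphs with at most seven vertices\<close>

lemma blue_if_le_p: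
  assumes "Y \<preceq> p K" "\<not> Y \<preceq> zero" "finite K"
  obtains b where "b \<in> K" "c b = Blue"
  using assms le_zero_if_le_p [of Y K] by (auto simp: at_most_blue_def)

lemma not_hot_le_if_at_most_one_blue:
  assumes "hot \<preceq> p K" "at_most_blue 1 c K"
  shows False
proof -
  have [simp]: "finite K"
    using assms(2) by (rule finite_if_at_most_blue)
  have "\<not> p K \<preceq> one"
    using assms(1) by (simp add: le_p_iff)
  then obtain b where "b \<in> K" "c b = Blue" "one \<preceq> p (del K b)"
    by (auto simp: p_le_iff)
  then show False
    using assms(2) at_most_blue_del [of 0] le_zero_if_le_p not_game_le by fastforce
qed

text \<open>After a red move Left would need an answer above \<open>one\<close>, but that answer
  uses up the last blue vertex.\<close>

lemma no_red_if_one_le: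
  assumes "one \<preceq> p K" "at_most_blue 1 c K" "r \<in> K"
  shows "c r = Blue"
proof (rule ccontr)
  have [simp]: "finite K"
    using assms(2) by (rule finite_if_at_most_blue)
  assume "c r \<noteq> Blue"
  then have "c r = Red"
    using colour.exhaust by blast
  then have "\<not> p (del K r) \<preceq> one"
    using assms by (simp add: le_p_iff)
  then obtain b where "b \<in> del K r" "c b = Blue" "one \<preceq> p (del (del K r) b)"
    by (auto simp: p_le_iff)
  then show False
    using assms(2) at_most_blue_del [of 0 "del K r"] at_most_blue_del_any le_zero_if_le_p
      not_game_le by fastforce
qed

lemma card_ge_if_at_most_three_blue:
  assumes S: "at_most_blue 3 c S" "p S \<preceq> witness" "witness \<preceq> p S"
  shows "card S \<ge> 8"
proof (rule ccontr)
  assume "\<not> ?thesis"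
  have [simp]: "finite S"
    using S(1) by (rule finite_if_at_most_blue)
  note del = del_def
  have blue2: "at_most_blue 2 c (del S x)" if "x \<in> S" "c x = Blue" for x
    using S(1) that at_most_blue_del [of 2] by (simp add: numeral_3_eq_3 numeral_2_eq_2)
  have blue1: "at_most_blue 1 c (del (del S x) y)"
    if "x \<in> S" "c x = Blue" "y \<in> del S x" "c y = Blue" for x y
    using blue2 [OF that(1,2)] that at_most_blue_del [of 1] by (simp add: numeral_2_eq_2)
  obtain v where v: "v \<in> S" "c v = Blue" "up_star \<preceq> p (del S v)" "p (del S v) \<preceq> up_star"
    using robust_option [OF robust_witness(1) S] by blast
  obtain w where w: "w \<in> S" "c w = Blue" "hot \<preceq> p (del S w)" "p (del S w) \<preceq> hot"
    using robust_option [OF robust_witness(2) S] by blast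
  \<comment> \<open>The option \<open>zero\<close> is not robust and yields only one
    inequality.\<close>
  have "\<not> p S \<preceq> zero"
    using S(3) by (simp add: le_p_iff)
  then obtain u where u: "u \<in> S" "c u = Blue" "zero \<preceq> p (del S u)"
    by (auto simp: p_le_iff)
  have ne: "u \<noteq> v" "u \<noteq> w" "v \<noteq> w"
    using u(3) v(3,4) w(3,4) game_le_trans not_game_le by blast+
  have "card {x \<in> S. c x = Blue} \<le> card {u, v, w}"
    using S(1) ne by (simp add: at_most_blue_def)
  then have blues: "{u, v, w} = {x \<in> S. c x = Blue}"
    using u v w by (intro card_seteq) auto
  then have blue: "x \<in> {u, v, w}" if "x \<in> S" "c x = Blue" for x
    using that by blast
  have "S = {u, v, w} \<union> {x \<in> S. c x = Red}"
    unfolding blues using colour.exhaust by blast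
  moreover have "card ({u, v, w} \<union> {x \<in> S. c x = Red}) = 3 + card {x \<in> S. c x = Red}"
    using ne u v w by (subst card_Un_disjoint) auto
  ultimately have red4: "card {x \<in> S. c x = Red} \<le> 4"
    using \<open>\<not> card S \<ge> 8\<close> by presburger

  \<comment> \<open>As \<open>one\<close> has no Right options, a blue move must lead above
    it.\<close>
  have "\<not> p (del S w) \<preceq> one"
    using w(3) by (simp add: le_p_iff)
  then obtain x where x: "x \<in> del S w" "c x = Blue" "one \<preceq> p (del (del S w) x)"
    by (auto simp: p_le_iff)
  obtain y where y: "y \<in> del (del S w) x" "c y = Blue"
    using x(3) not_game_le by (auto elim: blue_if_le_p)
  have T: "del (del S w) x = {y}"
  proof -
    have "z = y" if "z \<in> del (del S w) x" for z
    proof -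
      have "c z = Blue"
        using no_red_if_one_le [OF x(3) _ that] blue1 w x by blast
      then show ?thesis
        using that x y blue by (auto simp: del)
    qed
    with y show ?thesis
      by blast
  qed
  \<comment> \<open>The Left option \<open>star\<close> of \<open>up_star\<close> needs a blue move
    after \<open>v\<close> that leaves a further blue vertex; so \<open>v\<close> deletes neither
    \<open>u\<close> nor \<open>w\<close>.\<close>
  have "\<not> p (del S v) \<preceq> star"
    using v(3) by (simp add: le_p_iff)
  moreover have "\<not> zero \<preceq> p (del S v)"
    using v(4) game_le_trans not_game_le by blast
  ultimately obtain x' where x': "x' \<in> del S v" "c x' = Blue" "star \<preceq> p (del (del S v) x')"
    by (auto simp: p_le_iff)
  obtain y' where y': "y' \<in> del (del S v) x'" "c y' = Blue"
    using x'(3) not_game_le by (auto elim: blue_if_le_p)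
  have Nv: "u \<in> del S v" "w \<in> del S v"
    using x' y' blue by (auto simp: del)
  \<comment> \<open>Otherwise \<open>w\<close> after \<open>v\<close> would leave just
    \<open>u\<close>, a position above \<open>one\<close> and so above
    \<open>up_star\<close>.\<close>
  have "x \<noteq> v"
  proof
    assume "x = v"
    then have "del (del S v) w = {u}"
      using T x y blue by (subst del_commute) (auto simp: del)
    then have "up_star \<preceq> p (del (del S v) w)"
      using up_star_le_one one_le_p_singleton u(2) game_le_trans by metis
    then show False
      using v(4) Nv w(2) by (simp add: p_le_iff)
  qed
  then have xy: "x = u" "y = v"
    using x y blue by (auto simp: del)
  have Nw: "u \<in> del S w"
    using x xy by simp
  have red_cover: "r \<in> N w \<union> N u" if "r \<in> S" "c r = Red" for r
  proof -
    have "r \<notin> del (del S w) u"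
      using T that xy v(2) by auto
    with that u w show ?thesis
      by (auto simp: del)
  qed
  have Nu: "v \<in> del S u"
  proof -
    have "v \<in> del (del S w) u"
      using T xy by simp
    then show ?thesis
      by (auto simp: del)
  qed
  have zero_le_w_u: "zero \<preceq> p K" if "K \<subseteq> del (del S w) u" for K
    using that T xy v by (intro zero_le_p) (auto intro: finite_subset)

  have "\<not> p (del S v) \<preceq> zero"
    using v(3) by (simp add: le_p_iff)
  then obtain z where z: "z \<in> del S v" "c z = Blue" "zero \<preceq> p (del (del S v) z)"
    by (auto simp: p_le_iff)
  \<comment> \<open>The options \<open>zero\<close> and \<open>star\<close> of
    \<open>up_star\<close> need different moves. A position \<open>K\<close> above both is not above
    \<open>up_star\<close>, so some red move leads below \<open>up_star\<close>; Left's answer above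
    \<open>star\<close> would then have no blue vertex.\<close>
  have "z \<noteq> x'"
  proof
    assume "z = x'"
    define K where "K = del (del S v) z"
    have K: "finite K" "at_most_blue 1 c K" "zero \<preceq> p K" "star \<preceq> p K"
      using z x' \<open>z = x'\<close> v blue1 by (auto simp: K_def)
    have "\<not> p K \<preceq> zero" "\<not> p K \<preceq> star"
      using K game_le_trans not_game_le by blast+
    moreover have "\<not> up_star \<preceq> p K"
      using v(4) z by (simp add: p_le_iff K_def)
    ultimately obtain r where r: "r \<in> K" "c r = Red" "p (del K r) \<preceq> up_star"
      using K(1) by (auto simp: le_p_iff)
    have "\<not> p (del K r) \<preceq> star"
      using K r by (simp add: le_p_iff)
    moreover have "\<not> zero \<preceq> p (del K r)"
      using r(3) game_le_trans not_game_le by blast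
    ultimately obtain b where "b \<in> del K r" "c b = Blue" "star \<preceq> p (del (del K r) b)"
      using K(1) by (auto simp: p_le_iff)
    then show False
      using K(2) at_most_blue_del [of 0 "del K r"] at_most_blue_del_any le_zero_if_le_p
        not_game_le by fastforce
  qed

  have not_kill: "\<exists>b \<in> del K r. c b = Blue"
    if "zero \<preceq> p K" "r \<in> K" "c r = Red" "finite K" for K r
  proof -
    have "\<not> p (del K r) \<preceq> zero"
      using that by (simp add: le_p_iff)
    then show ?thesis
      using that(4) p_le_zero [of "del K r"] by (auto simp: at_most_blue_def)
  qed

  have nored_vu: "del (del S u) v = {}" if "w \<in> N u"
  proof -
    define K where "K = del (del S v) u"
    have noblue: "c b \<noteq> Blue" if "b \<in> K" for b
      using that \<open>w \<in> N u\<close> blue by (auto simp: K_def del)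
    then have "x' \<noteq> u"
      using x' y' unfolding K_def by blast
    then have "z = u"
      using \<open>z \<noteq> x'\<close> x' z blue by (auto simp: del)
    then have "zero \<preceq> p K"
      using z by (simp add: K_def)
    then have "c b \<noteq> Red" if "b \<in> K" for b
      using not_kill [of K b] that noblue del_subset [of K] by (auto simp: K_def)
    with noblue have "K = {}"
      using colour.exhaust by blast
    then show ?thesis
      by (simp add: K_def del_commute)
  qed
  \<comment> \<open>In both cases the position after \<open>u\<close> and \<open>b\<close> is
    \<open>\<ge> 0\<close>: it is empty if \<open>u\<close> deletes \<open>w\<close>, and otherwise
    contained in \<open>{v}\<close>.\<close>
  define b where "b = (if w \<in> N u then v else w)"
  have b: "b \<in> del S u" "c b = Blue"
    using Nu ne v w by (auto simp: b_def del)
  have zero_le_u_b: "zero \<preceq> p K" if "K \<subseteq> del (del S u) b" for K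
    using that nored_vu zero_le_w_u zero_le_p [of K] del_commute [of S u w]
    by (auto simp: b_def split: if_splits)
  have "\<not> p (del S u) \<preceq> zero"
    using b zero_le_u_b by (auto simp: p_le_iff)
  moreover have "\<not> p (del S u) \<preceq> up_star" "\<not> p (del S u) \<preceq> hot"
    using u(3) game_le_trans not_game_le by blast+
  moreover have "\<not> witness \<preceq> p (del S u)"
    using S(2) u by (simp add: p_le_iff)
  \<comment> \<open>No Left option of \<open>witness\<close> is above \<open>p (del S u)\<close>, so
    a red move \<open>t\<close> must lead below \<open>witness\<close>. As \<open>zero\<close> is
    not below \<open>witness\<close>, Right can move on to a position
    \<open>\<le> 0\<close>.\<close>
  ultimately obtain t where t: "t \<in> del S u" "c t = Red" "p (del (del S u) t) \<preceq> witness"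
    by (auto simp: le_p_iff)
  have "\<not> zero \<preceq> p (del (del S u) t)"
    using t(3) game_le_trans not_game_le by blast
  then obtain t' where t': "t' \<in> del (del S u) t" "c t' = Red"
    "p (del (del (del S u) t) t') \<preceq> zero"
    by (auto simp: le_p_iff)
  \<comment> \<open>Otherwise Left could still play \<open>b\<close> and reach a position
    \<open>\<ge> 0\<close>.\<close>
  have kill: "b \<in> N t \<union> N t'"
  proof (rule ccontr)
    assume "b \<notin> N t \<union> N t'"
    then have "b \<in> del (del (del S u) t) t'"
      using b t t' by (auto simp: del)
    moreover have "zero \<preceq> p (del (del (del (del S u) t) t') b)"
      by (rule zero_le_u_b) (auto simp: del)
    ultimately show False
      using t'(3) b(2) by (auto simp: p_le_iff)
  qed
  \<comment> \<open>If \<open>u\<close> deleted \<open>w\<close>, the only blue vertex after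
    \<open>u\<close> would be \<open>b = v\<close>, which no red vertex may delete by
    \<open>not_kill\<close>.\<close>
  have Nuw: "w \<notin> N u"
  proof
    assume "w \<in> N u"
    then have "v \<notin> N \<rho>" if "\<rho> \<in> del S u" "c \<rho> = Red" for \<rho>
      using not_kill [OF u(3) that] blue by (auto simp: del)
    then show False
      using kill \<open>w \<in> N u\<close> t t' by (auto simp: b_def del)
  qed

  have "\<not> zero \<preceq> p (del S w)"
    using w(4) by (simp add: p_le_iff)
  then obtain r where r: "r \<in> del S w" "c r = Red" "p (del (del S w) r) \<preceq> zero"
    by (auto simp: le_p_iff)
  have "\<not> star \<preceq> p (del S w)"
    using w(4) by (simp add: p_le_iff)
  moreover have "\<not> p (del S w) \<preceq> zero"
    using w(3) game_le_trans not_game_le by blast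
  ultimately obtain s where s: "s \<in> del S w" "c s = Red" "p (del (del S w) s) \<preceq> star"
    by (auto simp: le_p_iff)
  \<comment> \<open>A common position \<open>K\<close> would be below both Right options of
    \<open>hot\<close> but not below \<open>hot\<close>; this forces a blue move to a position above
    \<open>hot\<close> with at most one blue vertex.\<close>
  have "r \<noteq> s"
  proof
    assume "r = s"
    define K where "K = del (del S w) r"
    have K: "finite K" "p K \<preceq> zero" "p K \<preceq> star"
      using r s \<open>r = s\<close> by (auto simp: K_def)
    have "\<not> p K \<preceq> hot"
      using w(3) r by (simp add: le_p_iff K_def)
    moreover have "\<not> zero \<preceq> p K" "\<not> star \<preceq> p K"
      using K game_le_trans not_game_le by blast+
    ultimately obtain d where d: "d \<in> K" "c d = Blue" "hot \<preceq> p (del K d)"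
      using K(1) by (auto simp: p_le_iff)
    moreover have "at_most_blue 2 c K"
      using blue2 w at_most_blue_del_any by (simp add: K_def)
    ultimately show False
      using not_hot_le_if_at_most_one_blue [of "del K d"] at_most_blue_del [of 1 K d]
      by (simp add: numeral_2_eq_2)
  qed
  have "u \<in> N r"
  proof (rule ccontr)
    assume "u \<notin> N r"
    then have "u \<in> del (del S w) r"
      using Nw r u by (auto simp: del)
    moreover have "zero \<preceq> p (del (del (del S w) r) u)"
      by (rule zero_le_w_u) (auto simp: del)
    ultimately show False
      using r(3) u(2) by (auto simp: p_le_iff)
  qed
  \<comment> \<open>Here \<open>t\<close> and \<open>t'\<close> are deleted by \<open>w\<close>,
    whereas \<open>r\<close> and \<open>s\<close> survive it; so the four are distinct.\<close>
  have "{r, s, t, t'} = {\<rho> \<in> S. c \<rho> = Red}"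
  proof (rule card_seteq)
    have "t \<in> N w" "t' \<in> N w"
      using red_cover t t' by (auto simp: del)
    then have "card {r, s, t, t'} = 4"
      using r s t t' \<open>r \<noteq> s\<close> by (auto simp: del card_insert_if)
    then show "card {\<rho> \<in> S. c \<rho> = Red} \<le> card {r, s, t, t'}"
      using red4 by simp
  qed (use r s t t' in \<open>auto simp: del\<close>)
  then have red: "\<rho> \<in> {r, s, t, t'}" if "\<rho> \<in> S" "c \<rho> = Red" for \<rho>
    using that by blast

  \<comment> \<open>Treats \<open>z = u\<close> and \<open>z = w\<close> alike: \<open>a\<close> is
    the move, \<open>d\<close> the blue vertex left over, and \<open>t1\<close>, \<open>t2\<close>
    contain all red vertices surviving \<open>a\<close>.\<close>
  have key: False if z: "zero \<preceq> p (del (del S v) a)" and ad: "{a, d} = {u, w}" "a \<noteq> d"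
    and red: "\<And>\<rho>. \<rho> \<in> del S a \<Longrightarrow> c \<rho> = Red \<Longrightarrow> \<rho> \<in> {t1, t2}"
    and kill: "d \<in> N t1 \<union> N t2" for a d t1 t2
  proof -
    define K where "K = del (del S v) a"
    have [simp]: "finite K"
      by (simp add: K_def)
    have a: "a \<in> del S v" "c a = Blue" and d: "d \<in> K" "c d = Blue"
      using ad Nv Nw Nuw u w ne by (auto simp: K_def del doubleton_eq_iff)
    have blueK: "x = d" if "x \<in> K" "c x = Blue" for x
      using that blue ad by (auto simp: K_def del doubleton_eq_iff)
    have "zero \<preceq> p (del K d)"
      by (rule zero_le_w_u) (use ad in \<open>auto simp: K_def del doubleton_eq_iff\<close>)
    then have "\<not> p K \<preceq> zero"
      using d by (auto simp: p_le_iff)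
    moreover have "\<not> p K \<preceq> star"
      using z game_le_trans not_game_le unfolding K_def by blast
    moreover have "\<not> up_star \<preceq> p K"
      using v(4) a by (simp add: p_le_iff K_def)
    ultimately obtain \<rho> where \<rho>: "\<rho> \<in> K" "c \<rho> = Red" "p (del K \<rho>) \<preceq> up_star"
      by (auto simp: le_p_iff)
    have dN: "d \<in> del K \<sigma>" if "\<sigma> \<in> K" "c \<sigma> = Red" for \<sigma>
      using not_kill [of K \<sigma>] z that blueK del_subset [of K] by (auto simp: K_def)
    have "\<sigma> = d" if "\<sigma> \<in> del K \<rho>" for \<sigma>
    proof (cases "c \<sigma>")
      case Red
      then have "{\<sigma>, \<rho>} = {t1, t2}"
        using red [of \<sigma>] red [of \<rho>] \<rho> that by (auto simp: K_def del)
      then have "d \<notin> N t1 \<union> N t2"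
        using dN [of \<sigma>] dN [of \<rho>] \<rho> that Red by (auto simp: del doubleton_eq_iff)
      with kill show ?thesis
        by blast
    qed (use that blueK in \<open>auto simp: del\<close>)
    \<comment> \<open>A lone blue vertex is above \<open>one\<close>, which is not below
      \<open>up_star\<close>.\<close>
    then have "del K \<rho> = {d}"
      using dN \<rho> by blast
    then show False
      using \<rho>(3) one_le_p_singleton [OF d(2)] game_le_trans not_game_le by metis
  qed
  consider "z = u" | "z = w"
    using z blue by (auto simp: del)
  then show False
  proof cases
    case 1
    show False
    proof (rule key)
      show "w \<in> N t \<union> N t'"
        using kill Nuw by (simp add: b_def)
      show "\<rho> \<in> {t, t'}" if "\<rho> \<in> del S u" "c \<rho> = Red" for \<rho>
        using red [of \<rho>] red_cover [of r] red_cover [of s] r s that by (auto simp: del)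
    qed (use z 1 ne in auto)
  next
    case 2
    show False
    proof (rule key)
      show "u \<in> N r \<union> N s"
        using \<open>u \<in> N r\<close> by simp
      show "\<rho> \<in> {r, s}" if "\<rho> \<in> del S w" "c \<rho> = Red" for \<rho>
        using red [of \<rho>] red_cover [of t] red_cover [of t'] t t' that by (auto simp: del)
    qed (use z 2 ne in auto)
  qed
qed

end


text \<open>One of the colours occurs at most three times; if it is red, exchange the colours, since
  the witness is its own negative.\<close>

lemma card_ge_if_eq_witness:
  assumes "finite S" "game_eq (pos N c S) witness"
  shows "card S \<ge> 8"
proof (rule ccontr)
  assume "\<not> ?thesis"
  have le: "pos N c S \<preceq> witness" "witness \<preceq> pos N c S"
    using game_le_if_game_eq [OF assms(2)] by blast+
  then have le': "pos N (swap_colour \<circ> c) S \<preceq> witness" "witness \<preceq> pos N (swap_colour \<circ> c) S"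
    using uminus_game_le [of "pos N c S" witness] uminus_game_le [of witness "pos N c S"]
    by (simp_all add: uminus_pos assms(1) uminus_witness)
  have "card {x \<in> S. c x = Blue} + card {x \<in> S. c x = Red} =
      card ({x \<in> S. c x = Blue} \<union> {x \<in> S. c x = Red})"
    using assms(1) by (intro card_Un_disjoint [symmetric]) auto
  also have "{x \<in> S. c x = Blue} \<union> {x \<in> S. c x = Red} = S"
    using colour.exhaust by blast
  finally have "card {x \<in> S. c x = Blue} \<le> 3 \<or> card {x \<in> S. c x = Red} \<le> 3"
    using \<open>\<not> card S \<ge> 8\<close> by linarith
  then have "at_most_blue 3 c S \<or> at_most_blue 3 (swap_colour \<circ> c) S"
    using assms(1) by (simp add: at_most_blue_def)
  then show False
    using placement.card_ge_if_at_most_three_blue le le' \<open>\<not> card S \<ge> 8\<close> by metis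
qed

section \<open>A digraph for the witness\<close>

text \<open>With lists, deletion becomes \<open>filter\<close>, which the simplifier can
  evaluate.\<close>

definition pos_list :: "('a \<Rightarrow> 'a set) \<Rightarrow> ('a \<Rightarrow> colour) \<Rightarrow> 'a list \<Rightarrow> game" where
  "pos_list N c xs = pos N c (set xs)"

lemma pos_list_rec:
  "pos_list N c xs = Game
    (fset_of_list (map (\<lambda>u. pos_list N c (filter (\<lambda>v. v \<noteq> u \<and> v \<notin> N u) xs))
      (filter (\<lambda>u. c u = Blue) xs)))
    (fset_of_list (map (\<lambda>u. pos_list N c (filter (\<lambda>v. v \<noteq> u \<and> v \<notin> N u) xs))
      (filter (\<lambda>u. c u = Red) xs)))"
proof -
  have "set xs - insert u (N u) = set (filter (\<lambda>v. v \<noteq> u \<and> v \<notin> N u) xs)" for u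
    by auto
  then show ?thesis
    unfolding pos_list_def by (intro game_eqI) (auto simp: opts_pos fset_of_list.rep_eq)
qed

text \<open>As a congruence rule, this keeps the simplifier from unfolding the recursion of
  \<^const>\<open>pos_list\<close> below the abstraction.\<close>

lemma map_weak_cong: "xs = ys \<Longrightarrow> map f xs = map f ys"
  by simp

text \<open>These instances fire only once the filtered list is explicit.\<close>

lemmas pos_list_simps = pos_list_rec [of _ _ "[]"] pos_list_rec [of _ _ "x # xs" for x xs]

text \<open>These arcs were found by a SAT solver.\<close>

definition arcs8 :: "(nat \<times> nat) set" where
  "arcs8 = {(0, 2), (0, 3), (0, 4), (0, 5), (0, 6), (1, 0), (1, 4), (1, 5),
    (1, 7), (2, 0), (2, 4), (2, 7), (3, 2), (3, 6), (3, 7), (4, 1),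
    (4, 2), (4, 3), (4, 7), (5, 0), (5, 1), (5, 4), (5, 6), (5, 7),
    (6, 2), (6, 3), (6, 4), (7, 0), (7, 1), (7, 3), (7, 4), (7, 6)}"

definition colour8 :: "nat \<Rightarrow> colour" where
  "colour8 u = (if u < 4 then Blue else Red)"

lemma pos8:
  "pos_list (\<lambda>u. {v. (u, v) \<in> arcs8}) colour8 [0, 1, 2, 3, 4, 5, 6, 7] \<preceq> witness"
  "witness \<preceq> pos_list (\<lambda>u. {v. (u, v) \<in> arcs8}) colour8 [0, 1, 2, 3, 4, 5, 6, 7]"
  by (simp_all add: pos_list_simps arcs8_def colour8_def game_defs game_le_Game
      cong: map_weak_cong)

text \<open>Makes the \<open>LEAST\<close> in \<open>placement_number\<close> meaningful: without
  some digraph of this value, the minimum need not be attained.\<close>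

lemma placement_game_eq_witness:
  "\<exists>G :: nat pair_pre_digraph. \<exists>c. pair_digraph G \<and> game_eq (placement_game G c) witness"
proof -
  define G :: "nat pair_pre_digraph" where "G = \<lparr> pverts = {0, 1, 2, 3, 4, 5, 6, 7}, parcs = arcs8 \<rparr>"
  have "pair_digraph G"
    by unfold_locales (auto simp: G_def arcs8_def)
  moreover have "placement_game G colour8 =
      pos_list (\<lambda>u. {v. (u, v) \<in> arcs8}) colour8 [0, 1, 2, 3, 4, 5, 6, 7]"
    using placement_game_eq_pos [of G "\<lambda>u. {v. (u, v) \<in> arcs8}" colour8]
    by (simp add: pos_list_def G_def closed_out_nbhd_def)
  ultimately show ?thesis
    using game_eq_if_game_le [OF pos8] by metis
qed

theorem theorem3p7:
  shows "\<exists>X. birthday X = 3 \<and> game_eq X (- X) \<and> placement_number X \<ge> 8"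
proof (intro exI conjI)
  show "birthday witness = 3"
    by (rule birthday_witness)
  show "game_eq witness (- witness)"
    by (simp add: uminus_witness game_eq_def)
  have "\<exists>n. \<exists>(G :: nat pair_pre_digraph) \<phi>.
      pair_digraph G \<and> card (pverts G) = n \<and> game_eq (placement_game G \<phi>) witness"
    using placement_game_eq_witness by blast
  then have "\<exists>(G :: nat pair_pre_digraph) \<phi>. pair_digraph G \<and>
      card (pverts G) = placement_number witness \<and> game_eq (placement_game G \<phi>) witness"
    unfolding placement_number_def by (rule LeastI_ex)
  then obtain G :: "nat pair_pre_digraph" and \<phi> where G: "pair_digraph G"
    "card (pverts G) = placement_number witness" "game_eq (placement_game G \<phi>) witness"
    by blast
  have "placement_game G \<phi> = pos (\<lambda>u. {v. (u, v) \<in> parcs G}) \<phi> (pverts G)"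
    by (rule placement_game_eq_pos) (simp add: closed_out_nbhd_def)
  moreover have "finite (pverts G)"
    using G(1) by (simp add: pair_digraph.axioms pair_fin_digraph.pair_finite_verts)
  ultimately show "placement_number witness \<ge> 8"
    using G card_ge_if_eq_witness by metis
qed

end
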